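(* Let $G$ be a group and let $H$ be a hyperbolically embedded subgroup of $G$. Then the extension problem for $H\le G$ is solvable.
   Context: All group actions on metric spaces are by isometries. Let a group $H$ act on metric spaces $(R,d_R)$ and $(S,d_S)$. A map $f\colon R\to S$ is coarsely $H$-equivariant if for every $x\in R$ we have $\sup_{h\in H} d_S(f(hx),hf(x))<\infty$. It is a quasi-isometric embedding if there is a constant $C$ such that $\frac1C d_R(x,y)-C\le d_S(f(x),f(y))\le C d_R(x,y)+C$ for all $x,y\in R$. Let $H\le G$ and let $H$ act on a metric space $R$. An action of $G$ on a (possibly different) metric space $S$ is an extension of the action of $H$ on $R$ if there exists a coarsely $H$-equivariant quasi-isometric embedding $R\to S$. The extension problem is solvable for $H\le G$ if every action of $H$ on a metric space has an extension to an action of $G$ on some metric space. Hyperbolically embedded subgroup. Let $X\subseteq G$ be a symmetric (not necessarily finite) subset with $G=\langle X\cup H\rangle$. Let $\Gamma(G,X\sqcup H)$ be the Cayley graph whose edges are labeled by the disjoint union $X\sqcup H$ (an element lying in both $X$ and $H$ gives two distinct letters, hence two distinct edges). The complete graph $\Gamma(H,H)$ (vertices $H$, edges labeled by letters from $H$) is a subgraph of $\Gamma(G,X\sqcup H)$. For $h,k\in H$ let $\widehat d(h,k)\in[0,\infty]$ be the length of a shortest path from $h$ to $k$ in the graph obtained from $\Gamma(G,X\sqcup H)$ by removing all edges (but no vertices) of $\Gamma(H,H)$, with $\widehat d(h,k)=\infty$ if there is no such path. $H$ is hyperbolically embedded in $G$ with respect to $X$ if $\Gamma(G,X\sqcup H)$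 is a (Gromov) hyperbolic graph and every ball of finite radius in $(H,\widehat d)$ contains finitely many elements. $H$ is hyperbolically embedded in $G$ if this holds for some such $X$. *)

theory Defs
  imports
    "HOL-Analysis.Abstract_Metric_Spaces"
    "HOL-Algebra.Group_Action"
    "HOL-Algebra.Generated_Groups"
    "Graph_Theory.Shortest_Path"
begin

section \<open>Extensions of group actions on metric spaces\<close>

definition isometric_action ::
    "('g, 'm) monoid_scheme \<Rightarrow> 'r metric \<Rightarrow> ('g \<Rightarrow> 'r \<Rightarrow> 'r) \<Rightarrow> bool" where
  "isometric_action G R \<alpha> \<longleftrightarrow>
     group_action G (mspace R) \<alpha> \<and>
     (\<forall>g\<in>carrier G. \<forall>x\<in>mspace R. \<forall>y\<in>mspace R. mdist R (\<alpha> g x) (\<alpha> g y) = mdist R x y)"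

definition coarsely_equivariant ::
    "'g set \<Rightarrow> 'r metric \<Rightarrow> ('g \<Rightarrow> 'r \<Rightarrow> 'r) \<Rightarrow> 's metric \<Rightarrow> ('g \<Rightarrow> 's \<Rightarrow> 's) \<Rightarrow> ('r \<Rightarrow> 's) \<Rightarrow> bool" where
  "coarsely_equivariant H R \<alpha> S \<beta> f \<longleftrightarrow>
     (\<forall>x\<in>mspace R. bdd_above ((\<lambda>h. mdist S (f (\<alpha> h x)) (\<beta> h (f x))) ` H))"

text \<open>The condition \<open>C > 0\<close> is implicit in the customary formulation; it has to be stated here
  because \<open>1 / 0 = 0\<close> would turn constant maps into quasi-isometric embeddings.\<close>

definition quasi_isometric_embedding :: "'r metric \<Rightarrow> 's metric \<Rightarrow> ('r \<Rightarrow> 's) \<Rightarrow> bool" where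
  "quasi_isometric_embedding R S f \<longleftrightarrow>
     f \<in> mspace R \<rightarrow> mspace S \<and>
     (\<exists>C>0. \<forall>x\<in>mspace R. \<forall>y\<in>mspace R.
        1 / C * mdist R x y - C \<le> mdist S (f x) (f y) \<and>
        mdist S (f x) (f y) \<le> C * mdist R x y + C)"

definition action_extension ::
    "('g, 'm) monoid_scheme \<Rightarrow> 'g set \<Rightarrow> 'r metric \<Rightarrow> ('g \<Rightarrow> 'r \<Rightarrow> 'r) \<Rightarrow>
     's metric \<Rightarrow> ('g \<Rightarrow> 's \<Rightarrow> 's) \<Rightarrow> bool" where
  "action_extension G H R \<alpha> S \<beta> \<longleftrightarrow>
     isometric_action G S \<beta> \<and>
     (\<exists>f. coarsely_equivariant H R \<alpha> S \<beta> f \<and> quasi_isometric_embedding R S f)"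

text \<open>The metric spaces \<open>R\<close> range over all carriers in the type \<open>'r\<close>, which is itself arbitrary.
  HOL cannot quantify existentially over the type of the points of \<open>S\<close>. Taking \<open>'g \<times> 'r\<close> is no
  restriction: if an extension exists on a metric space over any type, then the union of the
  \<open>G\<close>-orbits meeting the image of \<open>R\<close> has a copy in \<open>'g \<times> 'r\<close>; this is
  \<open>action_extension_transfer\<close> below.\<close>

definition extension_problem_solvable ::
    "'r itself \<Rightarrow> ('g, 'm) monoid_scheme \<Rightarrow> 'g set \<Rightarrow> bool" where
  "extension_problem_solvable _ G H \<longleftrightarrow>
     (\<forall>(R :: 'r metric) \<alpha>. isometric_action (G\<lparr>carrier := H\<rparr>) R \<alpha> \<longrightarrow>
        (\<exists>(S :: ('g \<times> 'r) metric) \<beta>. action_extension G H R \<alpha> S \<beta>))"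

lemma action_extension_transfer:
  fixes G :: "('g, 'm) monoid_scheme" and R :: "'r metric" and S :: "'s metric"
  assumes G: "group G" and H: "H \<subseteq> carrier G" and ext: "action_extension G H R \<alpha> S \<beta>"
    and act: "isometric_action (G\<lparr>carrier := H\<rparr>) R \<alpha>"
  shows "\<exists>(S' :: ('g \<times> 'r) metric) \<beta>'. action_extension G H R \<alpha> S' \<beta>'"
proof -
  interpret G: group G by (rule G)
  from ext obtain f where isoS: "isometric_action G S \<beta>"
    and ceq: "coarsely_equivariant H R \<alpha> S \<beta> f" and qi: "quasi_isometric_embedding R S f"
    unfolding action_extension_def by blast
  interpret A: group_action G "mspace S" \<beta>
    using isoS unfolding isometric_action_def by blast
  interpret B: group_action "G\<lparr>carrier := H\<rparr>" "mspace R" \<alpha>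
    using act unfolding isometric_action_def by blast
  have f: "f x \<in> mspace S" if "x \<in> mspace R" for x
    using qi that unfolding quasi_isometric_embedding_def by blast
  have iso: "mdist S (\<beta> g x) (\<beta> g y) = mdist S x y"
    if "g \<in> carrier G" "x \<in> mspace S" "y \<in> mspace S" for g x y
    using isoS that unfolding isometric_action_def by blast
  define e where "e = (\<lambda>(g, x). \<beta> g (f x))"
  define P where "P = carrier G \<times> mspace R"
  define T where "T = e ` P"
  define j where "j = inv_into P e"
  define T' where "T' = j ` T"
  have TS: "T \<subseteq> mspace S"
    unfolding T_def P_def e_def using f A.element_image by auto
  have jT': "j t \<in> T'" if "t \<in> T" for t using that unfolding T'_def by blast
  have ej: "e (j t) = t" if "t \<in> T" for t
    using that unfolding j_def T_def by (rule f_inv_into_f)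
  have eT: "e p \<in> T" if "p \<in> T'" for p using that ej unfolding T'_def by auto
  have je: "j (e p) = p" if "p \<in> T'" for p using that ej unfolding T'_def by auto
  have bT: "\<beta> g t \<in> T" if g: "g \<in> carrier G" and t: "t \<in> T" for g t
  proof -
    obtain h x where h: "h \<in> carrier G" "x \<in> mspace R" "t = \<beta> h (f x)"
      using t unfolding T_def P_def e_def by auto
    have "\<beta> g t = \<beta> (g \<otimes>\<^bsub>G\<^esub> h) (f x)"
      using h g f A.composition_rule by simp
    also have "\<dots> = e (g \<otimes>\<^bsub>G\<^esub> h, x)" by (simp add: e_def)
    finally show ?thesis using h g unfolding T_def P_def by blast
  qed
  have fT: "f x \<in> T" if "x \<in> mspace R" for x
  proof -
    have "f x = e (\<one>\<^bsub>G\<^esub>, x)"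
      using A.id_eq_one f[OF that] unfolding e_def by (metis case_prod_conv restrict_apply')
    thus ?thesis using that unfolding T_def P_def by blast
  qed
  define d where "d = (\<lambda>p q. mdist S (e p) (e q))"
  interpret M: Metric_space T' d
  proof
    fix x y z
    show "0 \<le> d x y" "d x y = d y x" by (auto simp: d_def mdist_commute)
    show "(d x y = 0) = (x = y)" if "x \<in> T'" "y \<in> T'"
      using that eT TS je unfolding d_def
      by (metis Metric_space.zero Metric_space_mspace_mdist subsetD)
    show "d x z \<le> d x y + d y z" if "x \<in> T'" "y \<in> T'" "z \<in> T'"
      using that eT TS unfolding d_def by (meson mdist_triangle subsetD)
  qed
  define S' where "S' = metric (T', d)"
  have S': "mspace S' = T'" "mdist S' = d"
    unfolding S'_def by (simp_all add: M.Metric_space_axioms)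
  define \<beta>' where "\<beta>' = (\<lambda>g. \<lambda>p\<in>T'. j (\<beta> g (e p)))"
  have clos: "\<beta>' g p \<in> T'" if "g \<in> carrier G" "p \<in> T'" for g p
    using that bT eT jT' by (simp add: \<beta>'_def)
  have mult: "\<beta>' (g \<otimes>\<^bsub>G\<^esub> h) p = \<beta>' g (\<beta>' h p)"
    if "g \<in> carrier G" "h \<in> carrier G" "p \<in> T'" for g h p
  proof -
    have "\<beta> (g \<otimes>\<^bsub>G\<^esub> h) (e p) = \<beta> g (\<beta> h (e p))"
      using that eT TS A.composition_rule by blast
    thus ?thesis using that bT eT jT' ej by (simp add: \<beta>'_def)
  qed
  have one: "\<beta>' \<one>\<^bsub>G\<^esub> p = p" if "p \<in> T'" for p
  proof -
    have "\<beta> \<one>\<^bsub>G\<^esub> (e p) = e p"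
      using that eT TS A.id_eq_one by (metis restrict_apply' subsetD)
    thus ?thesis using that je by (simp add: \<beta>'_def)
  qed
  have Bij: "\<beta>' g \<in> Bij T'" if g: "g \<in> carrier G" for g
  proof -
    have "bij_betw (\<beta>' g) T' T'"
    proof (rule bij_betw_byWitness[where f' = "\<beta>' (inv\<^bsub>G\<^esub> g)"])
      show "\<forall>a\<in>T'. \<beta>' (inv\<^bsub>G\<^esub> g) (\<beta>' g a) = a"
        using g one by (simp flip: mult)
      show "\<forall>a\<in>T'. \<beta>' g (\<beta>' (inv\<^bsub>G\<^esub> g) a) = a"
        using g one by (simp flip: mult)
    qed (use g clos in auto)
    moreover have "\<beta>' g \<in> extensional T'" by (simp add: \<beta>'_def)
    ultimately show ?thesis by (simp add: Bij_def)
  qed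
  have "group_action G T' \<beta>'"
  proof -
    have "\<beta>' \<in> hom G (BijGroup T')"
    proof (rule homI)
      fix g h assume gh: "g \<in> carrier G" "h \<in> carrier G"
      have "\<beta>' (g \<otimes>\<^bsub>G\<^esub> h) = compose T' (\<beta>' g) (\<beta>' h)"
        by (rule extensionalityI[of _ T'])
          (use gh mult in \<open>auto simp: compose_def \<beta>'_def[abs_def]\<close>)
      thus "\<beta>' (g \<otimes>\<^bsub>G\<^esub> h) = \<beta>' g \<otimes>\<^bsub>BijGroup T'\<^esub> \<beta>' h"
        using gh Bij by (simp add: BijGroup_def)
    qed (simp add: BijGroup_def Bij)
    thus ?thesis
      unfolding group_action_def group_hom_def group_hom_axioms_def
      using G group_BijGroup by blast
  qed
  moreover have "d (\<beta>' g x) (\<beta>' g y) = d x y"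
    if "g \<in> carrier G" "x \<in> T'" "y \<in> T'" for g x y
  proof -
    have "d (\<beta>' g x) (\<beta>' g y) = mdist S (\<beta> g (e x)) (\<beta> g (e y))"
      using that bT eT ej by (simp add: \<beta>'_def d_def)
    also have "\<dots> = d x y"
      unfolding d_def using that eT TS by (intro iso) blast+
    finally show ?thesis .
  qed
  ultimately have "isometric_action G S' \<beta>'"
    unfolding isometric_action_def S' by blast
  moreover have "coarsely_equivariant H R \<alpha> S' \<beta>' (j \<circ> f)"
    unfolding coarsely_equivariant_def
  proof
    fix x assume x: "x \<in> mspace R"
    have "mdist S' ((j \<circ> f) (\<alpha> h x)) (\<beta>' h ((j \<circ> f) x)) = mdist S (f (\<alpha> h x)) (\<beta> h (f x))"
      if h: "h \<in> H" for h
    proof -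
      have "\<alpha> h x \<in> mspace R" using B.element_image h x by simp
      thus ?thesis
        using h H x fT bT jT' ej by (auto simp: S' d_def \<beta>'_def subset_iff)
    qed
    hence "(\<lambda>h. mdist S' ((j \<circ> f) (\<alpha> h x)) (\<beta>' h ((j \<circ> f) x))) ` H =
           (\<lambda>h. mdist S (f (\<alpha> h x)) (\<beta> h (f x))) ` H"
      by (intro image_cong) auto
    thus "bdd_above ((\<lambda>h. mdist S' ((j \<circ> f) (\<alpha> h x)) (\<beta>' h ((j \<circ> f) x))) ` H)"
      using ceq x unfolding coarsely_equivariant_def by simp
  qed
  moreover have "quasi_isometric_embedding R S' (j \<circ> f)"
  proof -
    have "mdist S' ((j \<circ> f) x) ((j \<circ> f) y) = mdist S (f x) (f y)"
      if "x \<in> mspace R" "y \<in> mspace R" for x y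
      using that fT ej by (simp add: S' d_def)
    moreover have "j \<circ> f \<in> mspace R \<rightarrow> mspace S'"
      using fT jT' by (auto simp: S')
    ultimately show ?thesis
      using qi unfolding quasi_isometric_embedding_def by simp
  qed
  ultimately show ?thesis unfolding action_extension_def by blast
qed


section \<open>Hyperbolically embedded subgroups\<close>

text \<open>Graphs are multigraphs with symmetric arcs: an unoriented edge is represented by its two
  orientations. All edges have length 1, so the graph distance is the infimum of the lengths of
  arc walks, \<open>\<infinity>\<close> if there are none.\<close>

definition graph_dist :: "('v, 'e) pre_digraph \<Rightarrow> 'v \<Rightarrow> 'v \<Rightarrow> ereal" where
  "graph_dist D = wf_digraph.\<mu> D (\<lambda>_. 1)"

definition geodesic :: "('v, 'e) pre_digraph \<Rightarrow> 'v \<Rightarrow> 'e awalk \<Rightarrow> 'v \<Rightarrow> bool" where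
  "geodesic D u p v \<longleftrightarrow> pre_digraph.awalk D u p v \<and> ereal (length p) = graph_dist D u v"

text \<open>Gromov hyperbolicity of a connected graph: geodesic triangles are uniformly slim. Triangles
  have their corners at vertices, and the distance is tested at vertices; passing to arbitrary
  points on the edges only changes \<open>\<delta>\<close>. By cyclic symmetry, the condition for the first
  side covers all three sides.\<close>

definition hyperbolic_graph :: "('v, 'e) pre_digraph \<Rightarrow> bool" where
  "hyperbolic_graph D \<longleftrightarrow>
     (\<exists>\<delta>::real. \<forall>x y z p q r.
        geodesic D x p y \<and> geodesic D y q z \<and> geodesic D z r x \<longrightarrow>
        (\<forall>a\<in>set (pre_digraph.awalk_verts D x p).
         \<exists>b\<in>set (pre_digraph.awalk_verts D y q) \<union> set (pre_digraph.awalk_verts D z r).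
            graph_dist D a b \<le> ereal \<delta>))"

text \<open>The arc \<open>(g, s)\<close> leads from \<open>g\<close> to \<open>g s\<close>. The letters \<open>s\<close> come from the disjoint union
  \<open>X <+> H\<close>, with \<open>Inl\<close> for \<open>X\<close> and \<open>Inr\<close> for \<open>H\<close>.\<close>

definition cayley_graph ::
    "('g, 'm) monoid_scheme \<Rightarrow> 'g set \<Rightarrow> 'g set \<Rightarrow> ('g, 'g \<times> ('g + 'g)) pre_digraph" where
  "cayley_graph G X H =
     \<lparr>verts = carrier G,
      arcs = carrier G \<times> (X <+> H),
      tail = fst,
      head = (\<lambda>(g, s). g \<otimes>\<^bsub>G\<^esub> case_sum id id s)\<rparr>"

text \<open>\<open>H \<times> Inr ` H\<close> consists of the arcs of the complete subgraph on \<open>H\<close>.\<close>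

definition relative_graph ::
    "('g, 'm) monoid_scheme \<Rightarrow> 'g set \<Rightarrow> 'g set \<Rightarrow> ('g, 'g \<times> ('g + 'g)) pre_digraph" where
  "relative_graph G X H =
     (cayley_graph G X H)\<lparr>arcs := arcs (cayley_graph G X H) - H \<times> Inr ` H\<rparr>"

definition relative_dist ::
    "('g, 'm) monoid_scheme \<Rightarrow> 'g set \<Rightarrow> 'g set \<Rightarrow> 'g \<Rightarrow> 'g \<Rightarrow> ereal" where
  "relative_dist G X H = graph_dist (relative_graph G X H)"

definition hyperbolically_embedded_wrt ::
    "('g, 'm) monoid_scheme \<Rightarrow> 'g set \<Rightarrow> 'g set \<Rightarrow> bool" where
  "hyperbolically_embedded_wrt G X H \<longleftrightarrow>
     X \<subseteq> carrier G \<and> (\<forall>x\<in>X. inv\<^bsub>G\<^esub> x \<in> X) \<and> generate G (X \<union> H) = carrier G \<and>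
     hyperbolic_graph (cayley_graph G X H) \<and>
     (\<forall>h\<in>H. \<forall>r::real. finite {k \<in> H. relative_dist G X H h k \<le> ereal r})"

definition hyperbolically_embedded :: "('g, 'm) monoid_scheme \<Rightarrow> 'g set \<Rightarrow> bool" where
  "hyperbolically_embedded G H \<longleftrightarrow> (\<exists>X. hyperbolically_embedded_wrt G X H)"

text \<open>\<open>wf_digraph.\<mu>\<close> is specified for well-formed digraphs only.\<close>

lemma wf_cayley_graph:
  assumes "group G" "X \<subseteq> carrier G" "H \<subseteq> carrier G"
  shows "wf_digraph (cayley_graph G X H)"
proof -
  interpret group G by (rule assms)
  show ?thesis
    using assms(2,3) by unfold_locales (auto simp: cayley_graph_def)
qed

lemma wf_relative_graph:
  assumes "group G" "X \<subseteq> carrier G" "H \<subseteq> carrier G"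
  shows "wf_digraph (relative_graph G X H)"
proof -
  interpret group G by (rule assms)
  show ?thesis
    using assms(2,3) by unfold_locales (auto simp: relative_graph_def cayley_graph_def)
qed

end

theory Submission
  imports Defs
begin

text \<open>Attach a copy of the given \<open>H\<close>-space to every coset \<open>gH\<close> and join the base points of the
  copies along the letters from \<open>X\<close>; \<open>G\<close> acts on the resulting space. The inclusion of the copy
  attached to \<open>H\<close> is Lipschitz, and distances in this copy can only be shortened by excursions,
  which project to walks in the relative graph. Hyperbolicity implies that the displacement
  \<open>h\<^sup>-\<^sup>1k\<close> of such a walk of length \<open>n\<close> between elements \<open>h, k\<close> of \<open>H\<close> is a product of at most \<open>n\<close>
  elements of a ball for the relative distance. That ball is finite, so the walk displaces the
  base point by at most a constant times \<open>n\<close>, and excursions shorten distances by at most a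
  constant factor.\<close>

section \<open>Walks in hyperbolic graphs\<close>

text \<open>For unreachable \<open>v\<close> the value is unspecified, so attainment and the
  triangle inequality are only claimed in a connected graph.\<close>

definition hop_dist :: "('v \<times> 'v) set \<Rightarrow> 'v \<Rightarrow> 'v \<Rightarrow> nat" where
  "hop_dist E u v = (LEAST n. (u, v) \<in> E ^^ n)"

lemma hop_dist_le: "(u, v) \<in> E ^^ n \<Longrightarrow> hop_dist E u v \<le> n"
  unfolding hop_dist_def by (rule Least_le)

lemma relpow_sym:
  assumes "sym E" "(u, v) \<in> E ^^ n"
  shows "(v, u) \<in> E ^^ n"
  using assms(2)
proof (induction n arbitrary: v)
  case (Suc n)
  then obtain w where "(u, w) \<in> E ^^ n" "(w, v) \<in> E" by auto
  then show ?case using Suc.IH assms(1) by (meson relpow_Suc_I2 symD)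
qed simp

lemma relpow_mono:
  fixes R S :: "('a \<times> 'a) set"
  assumes "R \<subseteq> S" "(u, v) \<in> R ^^ n"
  shows "(u, v) \<in> S ^^ n"
  using assms(2)
proof (induction n arbitrary: v)
  case (Suc n)
  then obtain w where "(u, w) \<in> R ^^ n" "(w, v) \<in> R" by auto
  then show ?case using Suc.IH[of w] assms(1) by auto
qed simp

lemma relpow_segment:
  assumes "\<And>i. i < n \<Longrightarrow> (f i, f (Suc i)) \<in> E" "i + j \<le> n"
  shows "(f i, f (i + j)) \<in> E ^^ j"
  using assms(2)
proof (induction j)
  case (Suc j)
  then have "(f i, f (i + j)) \<in> E ^^ j" "(f (i + j), f (Suc (i + j))) \<in> E"
    using assms(1) by auto
  then show ?case by auto
qed simp

locale connected_sym_graph =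
  fixes V :: "'v set" and E :: "('v \<times> 'v) set"
  assumes E_V: "E \<subseteq> V \<times> V"
    and sym_E: "sym E"
    and connected: "\<lbrakk>u \<in> V; v \<in> V\<rbrakk> \<Longrightarrow> \<exists>n. (u, v) \<in> E ^^ n"
begin

lemma hop_dist_walk: "\<lbrakk>u \<in> V; v \<in> V\<rbrakk> \<Longrightarrow> (u, v) \<in> E ^^ hop_dist E u v"
  unfolding hop_dist_def using connected by (rule LeastI_ex)

lemma hop_dist_sym: "hop_dist E u v = hop_dist E v u"
  unfolding hop_dist_def using relpow_sym[OF sym_E] by metis

lemma hop_dist_triangle:
  assumes "u \<in> V" "v \<in> V" "w \<in> V"
  shows "hop_dist E u w \<le> hop_dist E u v + hop_dist E v w"
  using assms by (intro hop_dist_le relpow_trans[OF hop_dist_walk hop_dist_walk])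

lemma relpow_V: "\<lbrakk>(u, v) \<in> E ^^ n; u \<in> V\<rbrakk> \<Longrightarrow> v \<in> V"
  using E_V by (cases n) auto

text \<open>Sides are encoded by distances alone: \<open>a\<close> lies on some geodesic from
  \<open>x\<close> to \<open>y\<close> exactly when the triangle inequality through \<open>a\<close>
  is an equality.\<close>

definition slim_triangles :: "nat \<Rightarrow> bool" where
  "slim_triangles \<delta> \<longleftrightarrow>
     (\<forall>x\<in>V. \<forall>y\<in>V. \<forall>z\<in>V. \<forall>a\<in>V. hop_dist E x y = hop_dist E x a + hop_dist E a y \<longrightarrow>
        (\<exists>b\<in>V. hop_dist E a b \<le> \<delta> \<and>
           (hop_dist E y z = hop_dist E y b + hop_dist E b z \<or>
            hop_dist E z x = hop_dist E z b + hop_dist E b x)))"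

text \<open>A vertex of the walk at maximal distance from its start cannot be the midpoint of a geodesic
  segment of length \<open>2 * m\<close>: slimness of the triangle spanned by this segment and the start would
  bring one end of the segment at least as far away.\<close>

lemma nongeodesic_segment:
  assumes slim: "slim_triangles \<delta>" and m: "2 * \<delta> < m" "2 * m \<le> n"
    and f: "\<And>i. i < n \<Longrightarrow> (f i, f (Suc i)) \<in> E" and ends: "f 0 \<in> V" "hop_dist E (f 0) (f n) \<le> 1"
  shows "\<exists>j. j + 2 * m \<le> n \<and> hop_dist E (f j) (f (j + 2 * m)) < 2 * m"
proof (rule ccontr)
  assume *: "\<not> ?thesis"
  have seg: "hop_dist E (f i) (f (i + j)) \<le> j" if "i + j \<le> n" for i j
    using relpow_segment[of n f E] f that by (intro hop_dist_le) blast
  have fV: "f i \<in> V" if "i \<le> n" for i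
    using relpow_segment[of n f E 0 i] f that ends(1) relpow_V by auto
  define D where "D = (\<lambda>i. hop_dist E (f i) (f 0)) ` {..n}"
  have "Max D \<in> D" unfolding D_def by (intro Max_in) auto
  then obtain i where i: "i \<le> n" "Max D = hop_dist E (f i) (f 0)"
    using D_def by blast
  have "hop_dist E (f j) (f 0) \<le> Max D" if "j \<le> n" for j
    using that unfolding D_def by (intro Max_ge) auto
  then have max: "\<And>j. j \<le> n \<Longrightarrow> hop_dist E (f j) (f 0) \<le> hop_dist E (f i) (f 0)"
    using i(2) by simp
  show False
  proof (cases "m \<le> i \<and> i + m \<le> n")
    case True
    define y z where "y = f (i - m)" and "z = f (i + m)"
    have V: "f i \<in> V" "y \<in> V" "z \<in> V" unfolding y_def z_def using fV True by auto
    have "i - m + 2 * m = i + m" using True by auto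
    then have "hop_dist E y z \<ge> 2 * m"
      using * True unfolding y_def z_def by (metis not_le)
    moreover have le: "hop_dist E y (f i) \<le> m" "hop_dist E (f i) z \<le> m"
      using seg[of "i - m" m] seg[of i m] True unfolding y_def z_def by auto
    moreover have "hop_dist E y z \<le> hop_dist E y (f i) + hop_dist E (f i) z"
      using V by (intro hop_dist_triangle) auto
    \<comment> \<open>Two halves of length at most \<open>m\<close> and a total of at least
      \<open>2 * m\<close> force equality, so \<open>f i\<close> lies on a geodesic from
      \<open>y\<close> to \<open>z\<close>.\<close>
    ultimately have mid: "hop_dist E y (f i) = m" "hop_dist E (f i) z = m" "hop_dist E y z = m + m"
      by auto
    then obtain b where b: "b \<in> V" "hop_dist E (f i) b \<le> \<delta>"
      "hop_dist E z (f 0) = hop_dist E z b + hop_dist E b (f 0) \<or>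
       hop_dist E (f 0) y = hop_dist E (f 0) b + hop_dist E b y"
      using slim V ends(1) unfolding slim_triangles_def by metis
    \<comment> \<open>Here \<open>w\<close> stands for either end of the segment. Since
      \<open>b\<close> is \<open>\<delta>\<close>-close to \<open>f i\<close>, its distance from
      \<open>w\<close> is at least \<open>m - \<delta>\<close>, which exceeds
      \<open>\<delta>\<close>; so \<open>w\<close> would be farther from \<open>f 0\<close> than
      \<open>f i\<close>.\<close>
    have far: False
      if w: "w \<in> V" "hop_dist E (f i) w = m"
        "hop_dist E w (f 0) \<le> hop_dist E (f i) (f 0)"
        "hop_dist E w (f 0) = hop_dist E w b + hop_dist E b (f 0)" for w
    proof -
      have "hop_dist E (f i) (f 0) \<le> hop_dist E (f i) b + hop_dist E b (f 0)"
        "hop_dist E (f i) w \<le> hop_dist E (f i) b + hop_dist E b w"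
        using V b ends w by (auto intro: hop_dist_triangle)
      then show False using w b m hop_dist_sym[of b w] by linarith
    qed
    show False
      using b(3)
    proof
      assume "hop_dist E z (f 0) = hop_dist E z b + hop_dist E b (f 0)"
      then show False
        using far[OF V(3) mid(2)] max[of "i + m"] True unfolding z_def by auto
    next
      assume "hop_dist E (f 0) y = hop_dist E (f 0) b + hop_dist E b y"
      then have "hop_dist E y (f 0) = hop_dist E y b + hop_dist E b (f 0)"
        using hop_dist_sym[of "f 0"] hop_dist_sym[of b y] by simp
      then show False
        using far[OF V(2)] mid(1) max[of "i - m"] i(1) hop_dist_sym[of "f i" y]
        unfolding y_def by simp
    qed
  next
    case False
    \<comment> \<open>Near an end of the walk the maximal distance is at most \<open>m\<close>: at
      the far end, fewer than \<open>m\<close> edges lead to \<open>f n\<close>, which is within 1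
      of \<open>f 0\<close>. But \<open>f (2 * m)\<close> is at distance at least
      \<open>2 * m\<close>, by assumption.\<close>
    have "hop_dist E (f i) (f 0) \<le> m"
    proof (cases "m \<le> i")
      case False
      then show ?thesis using seg[of 0 i] i hop_dist_sym[of "f i"] by auto
    next
      case True
      then have "n - i < m" using False i(1) by auto
      moreover have "hop_dist E (f i) (f n) \<le> n - i" using seg[of i "n - i"] i by auto
      moreover have "hop_dist E (f i) (f 0) \<le> hop_dist E (f i) (f n) + hop_dist E (f n) (f 0)"
        using fV i by (intro hop_dist_triangle) auto
      ultimately show ?thesis using ends(2) hop_dist_sym[of "f n"] by auto
    qed
    then have "hop_dist E (f (2 * m)) (f 0) \<le> m" using max[OF m(2)] by auto
    moreover have "\<not> hop_dist E (f 0) (f (2 * m)) < 2 * m"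
      using * m(2) by (metis add_0)
    ultimately show False using m(1) hop_dist_sym[of "f 0"] by auto
  qed
qed

end

text \<open>Everything from the first to the last clique edge is cut out; at least one edge
  disappears, whence the strict inequality.\<close>

lemma relpow_Un_clique:
  assumes "(a, b) \<in> (R \<union> H \<times> H) ^^ l"
  shows "(a, b) \<in> R ^^ l \<or>
    (\<exists>q\<in>H. \<exists>q'\<in>H. \<exists>i j. (a, q) \<in> R ^^ i \<and> (q', b) \<in> R ^^ j \<and> i + j < l)"
  using assms
proof (induction l arbitrary: b)
  case (Suc l)
  then obtain c where c: "(a, c) \<in> (R \<union> H \<times> H) ^^ l" "(c, b) \<in> R \<union> H \<times> H" by auto
  show ?case
  proof (cases "(c, b) \<in> R")
    case True
    then show ?thesis using Suc.IH[OF c(1)]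
      by (metis add_Suc_right not_less_eq relpow_Suc_I)
  next
    case False
    then have H: "c \<in> H" "b \<in> H" using c(2) by auto
    from Suc.IH[OF c(1)] show ?thesis
    proof
      assume "(a, c) \<in> R ^^ l"
      then show ?thesis using H by (metis add.right_neutral lessI relpow_0_I)
    next
      assume "\<exists>q\<in>H. \<exists>q'\<in>H. \<exists>i j. (a, q) \<in> R ^^ i \<and> (q', c) \<in> R ^^ j \<and> i + j < l"
      then obtain q i where "q \<in> H" "(a, q) \<in> R ^^ i" "i < Suc l" by auto
      then show ?thesis using H by (metis add.right_neutral relpow_0_I)
    qed
  qed
qed simp

text \<open>A substitute for the linear relative isoperimetric inequality. A long walk has a short
  nongeodesic segment, which is replaced by a geodesic. If the geodesic uses the clique
  \<open>H\<close>, then the walk is cut at its first and last clique edge; the cut points are at bounded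
  distance outside of the clique.\<close>

lemma (in connected_sym_graph) clique_displacement:
  assumes E: "E = R \<union> H \<times> H" and symR: "sym R"
    and slim: "slim_triangles \<delta>" and m: "2 * \<delta> < m" and B: "0 \<le> (B :: real)"
    and zero: "\<And>h. h \<in> H \<Longrightarrow> \<rho> h h \<le> 0"
    and triangle: "\<And>h k l. \<lbrakk>h \<in> H; k \<in> H; l \<in> H\<rbrakk> \<Longrightarrow> \<rho> h l \<le> \<rho> h k + \<rho> k l"
    and bound: "\<And>h k i. \<lbrakk>h \<in> H; k \<in> H; (h, k) \<in> R ^^ i; i \<le> 4 * m\<rbrakk> \<Longrightarrow> \<rho> h k \<le> B"
    and walk: "(h, k) \<in> R ^^ n" "h \<in> H" "k \<in> H"
  shows "\<rho> h k \<le> B * real n"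
  using walk
proof (induction n arbitrary: h k rule: less_induct)
  case (less n)
  consider "n = 0" | "0 < n" "n \<le> 4 * m" | "4 * m < n" by linarith
  then show ?case
  proof cases
    case 1
    then show ?thesis using less.prems zero by auto
  next
    case 2
    then have "\<rho> h k \<le> B" using bound less.prems by blast
    also have "\<dots> \<le> B * real n" using 2 B by (simp add: mult_le_cancel_left1)
    finally show ?thesis .
  next
    case 3
    obtain f where f: "f 0 = h" "f n = k" "\<And>i. i < n \<Longrightarrow> (f i, f (Suc i)) \<in> R"
      using less.prems(1) unfolding relpow_fun_conv by auto
    have hV: "h \<in> V" using E E_V less.prems(2) by auto
    \<comment> \<open>A clique edge joins \<open>h\<close> and \<open>k\<close>, so the walk closes
      up to within 1, as \<open>nongeodesic_segment\<close> demands.\<close>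
    have "hop_dist E h k \<le> 1"
      using E less.prems by (intro hop_dist_le) auto
    then obtain j where j: "j + 2 * m \<le> n" "hop_dist E (f j) (f (j + 2 * m)) < 2 * m"
      using nongeodesic_segment[OF slim m, of n f] 3 f E hV by auto
    define a b where "a = f j" and "b = f (j + 2 * m)"
    have ha: "(h, a) \<in> R ^^ j" and ab: "(a, b) \<in> R ^^ (2 * m)" and bk: "(b, k) \<in> R ^^ (n - j - 2 * m)"
      using relpow_segment[of n f R 0 j] relpow_segment[of n f R j "2 * m"]
        relpow_segment[of n f R "j + 2 * m" "n - j - 2 * m"] f j(1) unfolding a_def b_def by auto
    have mono: "(u, v) \<in> E ^^ i" if "(u, v) \<in> R ^^ i" for u v i
      using that relpow_mono[of R E] E by auto
    have "a \<in> V" "b \<in> V" using mono[OF ha] mono[OF ab] hV relpow_V by auto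
    then have "(a, b) \<in> (R \<union> H \<times> H) ^^ hop_dist E a b" using hop_dist_walk E by metis
    from relpow_Un_clique[OF this] show ?thesis
    proof
      let ?n = "j + hop_dist E a b + (n - j - 2 * m)"
      assume "(a, b) \<in> R ^^ hop_dist E a b"
      then have "(h, k) \<in> R ^^ ?n" using ha bk by (intro relpow_trans)
      moreover have "?n < n" using j unfolding a_def b_def by linarith
      ultimately have "\<rho> h k \<le> B * real ?n" using less by blast
      also have "\<dots> \<le> B * real n" using \<open>?n < n\<close> B by (intro mult_left_mono) auto
      finally show ?thesis .
    next
      assume "\<exists>q\<in>H. \<exists>q'\<in>H. \<exists>i i'. (a, q) \<in> R ^^ i \<and> (q', b) \<in> R ^^ i' \<and> i + i' < hop_dist E a b"
      then obtain q q' i i' where q: "q \<in> H" "q' \<in> H" "(a, q) \<in> R ^^ i" "(q', b) \<in> R ^^ i'"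
        "i + i' < hop_dist E a b" by blast
      have len: "i + i' < 2 * m" using q(5) j(2) unfolding a_def b_def by linarith
      let ?l = "j + i" and ?l' = "i' + (n - j - 2 * m)"
      \<comment> \<open>The cut segment of \<open>2 * m\<close> edges is longer than
        \<open>i + i'\<close>; the unit gained pays for passing from \<open>q\<close> to
        \<open>q'\<close>, which costs at most \<open>B\<close>.\<close>
      have lt: "?l + ?l' + 1 \<le> n" using j len by linarith
      have "\<rho> h q \<le> B * real ?l"
        using lt less.prems q relpow_trans[OF ha q(3)] by (intro less.IH) auto
      moreover have "\<rho> q' k \<le> B * real ?l'"
        using lt less.prems q relpow_trans[OF q(4) bk] by (intro less.IH) auto
      moreover have "\<rho> q q' \<le> B"
      proof (rule bound)
        \<comment> \<open>From \<open>q\<close> back to \<open>a\<close>, along the original walk to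
          \<open>b\<close>, then back to \<open>q'\<close>: fewer than \<open>4 * m\<close> edges,
          all in \<open>R\<close>.\<close>
        show "(q, q') \<in> R ^^ (i + 2 * m + i')"
          using relpow_sym[OF symR q(3)] relpow_sym[OF symR q(4)] ab by (blast intro: relpow_trans)
      qed (use q len in auto)
      moreover have "\<rho> h k \<le> \<rho> h q + \<rho> q q' + \<rho> q' k"
        using triangle[of h q k] triangle[of q q' k] q less.prems by auto
      ultimately have "\<rho> h k \<le> B * real (?l + ?l' + 1)" by (simp add: algebra_simps)
      also have "\<dots> \<le> B * real n" using lt B by (intro mult_left_mono) linarith+
      finally show ?thesis .
    qed
  qed
qed

section \<open>Walks as relation powers\<close>

context wf_digraph
begin

lemma awalk_relpow: "awalk u p v \<Longrightarrow> (u, v) \<in> arcs_ends G ^^ length p"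
proof (induction p arbitrary: u)
  case (Cons e p)
  then show ?case
    by (auto simp: awalk_Cons_iff intro: relpow_Suc_I2 in_arcs_imp_in_arcs_ends simp del: relpow.simps)
qed (simp add: awalk_Nil_iff)

lemma relpow_awalk:
  assumes "(u, v) \<in> arcs_ends G ^^ n" "u \<in> verts G"
  shows "\<exists>p. awalk u p v \<and> length p = n"
  using assms(1)
proof (induction n arbitrary: v)
  case 0
  then show ?case using assms(2) by (auto simp: awalk_Nil_iff)
next
  case (Suc n)
  then obtain w e where w: "(u, w) \<in> arcs_ends G ^^ n" "e \<in> arcs G" "tail G e = w" "head G e = v"
    by (auto simp: arcs_ends_conv)
  then obtain p where "awalk u p w" "length p = n" using Suc.IH by blast
  then have "awalk u (p @ [e]) v" "length (p @ [e]) = Suc n"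
    using arc_implies_awalk[OF w(2)] w by (auto intro: awalk_appendI)
  then show ?case by blast
qed

lemma awalk_cost_unit: "awalk_cost (\<lambda>_. 1) p = real (length p)"
  by (induction p) (auto simp: awalk_cost_def)

lemma graph_dist_le: "awalk u p v \<Longrightarrow> graph_dist G u v \<le> ereal (length p)"
  unfolding graph_dist_def using min_cost_le_walk_cost[of u p v "\<lambda>_. 1"]
  by (simp add: awalk_cost_unit)

lemma graph_dist_hop_dist:
  assumes "(u, v) \<in> arcs_ends G ^^ n" "u \<in> verts G"
  shows "graph_dist G u v = ereal (hop_dist (arcs_ends G) u v)"
proof (rule antisym)
  have "(u, v) \<in> arcs_ends G ^^ hop_dist (arcs_ends G) u v"
    unfolding hop_dist_def using assms(1) by (rule LeastI)
  then obtain p where "awalk u p v" "length p = hop_dist (arcs_ends G) u v"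
    using relpow_awalk assms(2) by blast
  then show "graph_dist G u v \<le> ereal (hop_dist (arcs_ends G) u v)"
    using graph_dist_le by fastforce
  show "ereal (hop_dist (arcs_ends G) u v) \<le> graph_dist G u v"
    unfolding graph_dist_def \<mu>_def
  proof (rule INF_greatest)
    fix p assume "p \<in> {p. awalk u p v}"
    then have "hop_dist (arcs_ends G) u v \<le> length p" by (auto intro: hop_dist_le awalk_relpow)
    then show "ereal (hop_dist (arcs_ends G) u v) \<le> ereal (awalk_cost (\<lambda>_. 1) p)"
      by (simp add: awalk_cost_unit)
  qed
qed

lemma geodesic_hop_dist:
  assumes "connected_sym_graph (verts G) (arcs_ends G)" "u \<in> verts G" "v \<in> verts G"
  shows "geodesic G u p v \<longleftrightarrow> awalk u p v \<and> length p = hop_dist (arcs_ends G) u v"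
  using graph_dist_hop_dist connected_sym_graph.connected[OF assms] assms(2)
  unfolding geodesic_def by force

text \<open>Slimness is assumed for every choice of geodesic sides, so the side through a prescribed
  \<open>a\<close> can be taken as two shortest walks joined at \<open>a\<close>.\<close>

lemma hyperbolic_graph_slim_triangles:
  assumes conn: "connected_sym_graph (verts G) (arcs_ends G)" and hyp: "hyperbolic_graph G"
  shows "\<exists>\<delta>. connected_sym_graph.slim_triangles (verts G) (arcs_ends G) \<delta>"
proof -
  interpret C: connected_sym_graph "verts G" "arcs_ends G" by (rule conn)
  let ?d = "hop_dist (arcs_ends G)"
  obtain \<delta> :: real where \<delta>: "\<And>x y z p q r a. \<lbrakk>geodesic G x p y; geodesic G y q z; geodesic G z r x;
      a \<in> set (awalk_verts x p)\<rbrakk> \<Longrightarrow>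
      \<exists>b\<in>set (awalk_verts y q) \<union> set (awalk_verts z r). graph_dist G a b \<le> ereal \<delta>"
    using hyp unfolding hyperbolic_graph_def by blast
  have walk: "\<exists>p. awalk u p v \<and> length p = ?d u v" if "u \<in> verts G" "v \<in> verts G" for u v
    using relpow_awalk C.hop_dist_walk that by blast
  have between: "?d u v = ?d u b + ?d b v"
    if p: "awalk u p v" "length p = ?d u v" "b \<in> set (awalk_verts u p)" for u p v b
  proof -
    obtain q r where qr: "p = q @ r" "awalk u q b" "awalk b r v"
      using awalk_decomp[OF p(1,3)] by blast
    then have "?d u b \<le> length q" "?d b v \<le> length r" by (auto intro!: hop_dist_le awalk_relpow)
    moreover have "?d u v \<le> ?d u b + ?d b v"
      using qr by (intro C.hop_dist_triangle) auto
    ultimately show ?thesis using p(2) qr(1) by auto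
  qed
  \<comment> \<open>Distances are natural numbers here, so the real constant may be rounded
    up.\<close>
  have "C.slim_triangles (nat \<lceil>\<delta>\<rceil>)"
    unfolding C.slim_triangles_def
  proof (intro ballI impI)
    fix x y z a
    assume V: "x \<in> verts G" "y \<in> verts G" "z \<in> verts G" "a \<in> verts G"
      and a: "?d x y = ?d x a + ?d a y"
    obtain p1 p2 q r where p: "awalk x p1 a" "length p1 = ?d x a" "awalk a p2 y" "length p2 = ?d a y"
      and q: "awalk y q z" "length q = ?d y z" and r: "awalk z r x" "length r = ?d z x"
      using walk V by metis
    have "awalk x (p1 @ p2) y" using p by (auto intro: awalk_appendI)
    moreover have "a \<in> set (awalk_verts x (p1 @ p2))"
      using set_awalk_verts_append[OF p(1,3)] hd_in_awalk_verts(1)[OF p(3)] by auto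
    ultimately obtain b where b: "b \<in> set (awalk_verts y q) \<union> set (awalk_verts z r)"
      "graph_dist G a b \<le> ereal \<delta>"
      using \<delta>[of x "p1 @ p2" y q z r a] geodesic_hop_dist[OF conn] V p q r a by auto
    have bV: "b \<in> verts G" using b(1) q(1) r(1) by auto
    then have "real (?d a b) \<le> \<delta>"
      using b(2) graph_dist_hop_dist C.connected[OF V(4)] V(4) by fastforce
    then have "?d a b \<le> nat \<lceil>\<delta>\<rceil>" by linarith
    then show "\<exists>b\<in>verts G. ?d a b \<le> nat \<lceil>\<delta>\<rceil> \<and>
        (?d y z = ?d y b + ?d b z \<or> ?d z x = ?d z b + ?d b x)"
      using b(1) bV between[OF q] between[OF r] by blast
  qed
  then show ?thesis by blast
qed

end

section \<open>The relative Cayley graph\<close>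

locale hyperbolically_embedded_subgroup = group G + H: subgroup H G for G (structure) and H +
  fixes X
  assumes hyp_emb: "hyperbolically_embedded_wrt G X H"
begin

lemma X_carrier: "x \<in> X \<Longrightarrow> x \<in> carrier G"
  and X_inv: "x \<in> X \<Longrightarrow> inv x \<in> X"
  and generate_X_H: "generate G (X \<union> H) = carrier G"
  and hyperbolic: "hyperbolic_graph (cayley_graph G X H)"
  and locally_finite: "h \<in> H \<Longrightarrow> finite {k \<in> H. relative_dist G X H h k \<le> ereal r}"
  using hyp_emb unfolding hyperbolically_embedded_wrt_def by auto

lemma X_subset: "X \<subseteq> carrier G"
  using X_carrier by auto

sublocale C: wf_digraph "cayley_graph G X H"
  by (rule wf_cayley_graph) (use X_subset H.subset is_group in auto)

sublocale R: wf_digraph "relative_graph G X H"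
  by (rule wf_relative_graph) (use X_subset H.subset is_group in auto)

abbreviation "\<E> \<equiv> arcs_ends (cayley_graph G X H)"
abbreviation "\<R> \<equiv> arcs_ends (relative_graph G X H)"

text \<open>Labels are forgotten here. Only \<open>H\<close>-letters read at an element of
  \<open>H\<close> are removed; an element of \<open>X\<close> lying in \<open>H\<close> keeps its
  edge inside \<open>H\<close>.\<close>

lemma relative_arc_iff:
  "(u, v) \<in> \<R> \<longleftrightarrow> u \<in> carrier G \<and> (\<exists>x. v = u \<otimes> x \<and> (x \<in> X \<or> x \<in> H \<and> u \<notin> H))"
  unfolding arcs_ends_conv relative_graph_def cayley_graph_def
  by (force simp: image_iff)

lemma cayley_arc_iff: "(u, v) \<in> \<E> \<longleftrightarrow> u \<in> carrier G \<and> (\<exists>x\<in>X \<union> H. v = u \<otimes> x)"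
  unfolding arcs_ends_conv cayley_graph_def by (force simp: image_iff)

lemma cayley_arcs: "\<E> = \<R> \<union> H \<times> H"
proof -
  have "(u, v) \<in> \<E> \<longleftrightarrow> (u, v) \<in> \<R> \<union> H \<times> H" for u v
  proof
    assume "(u, v) \<in> \<E>"
    then show "(u, v) \<in> \<R> \<union> H \<times> H" unfolding cayley_arc_iff Un_iff relative_arc_iff by auto
  next
    assume "(u, v) \<in> \<R> \<union> H \<times> H"
    moreover have "v = u \<otimes> (inv u \<otimes> v)" if "u \<in> H" "v \<in> H"
      using that by (simp add: m_assoc[symmetric])
    ultimately show "(u, v) \<in> \<E>" unfolding cayley_arc_iff Un_iff relative_arc_iff
      by (metis H.m_closed H.m_inv_closed H.mem_carrier UnCI mem_Sigma_iff)
  qed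
  then show ?thesis by auto
qed

lemma sym_relative: "sym \<R>"
proof (rule symI)
  fix u v assume "(u, v) \<in> \<R>"
  then obtain x where x: "u \<in> carrier G" "v = u \<otimes> x" "x \<in> X \<or> x \<in> H \<and> u \<notin> H"
    unfolding relative_arc_iff by auto
  then have xG: "x \<in> carrier G" using X_carrier by auto
  have "u = v \<otimes> inv x" using x xG by (simp add: m_assoc)
  \<comment> \<open>An \<open>H\<close>-letter read outside \<open>H\<close> ends outside
    \<open>H\<close>, so the reverse edge was not removed either.\<close>
  moreover have "v \<notin> H" if "x \<in> H" "u \<notin> H"
    using that calculation H.m_closed H.m_inv_closed by metis
  ultimately show "(v, u) \<in> \<R>"
    unfolding relative_arc_iff using x xG X_inv by (metis H.m_inv_closed m_closed)
qed

lemma connected_cayley: "connected_sym_graph (carrier G) \<E>"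
proof
  show "\<E> \<subseteq> carrier G \<times> carrier G"
    unfolding subset_iff using X_carrier by (auto simp: cayley_arc_iff)
  show "sym \<E>" unfolding cayley_arcs using sym_relative by (auto simp: sym_def)
  have reach: "\<forall>u\<in>carrier G. \<exists>n. (u, u \<otimes> w) \<in> \<E> ^^ n" if "w \<in> generate G (X \<union> H)" for w
    using that
  proof induction
    case one
    then show ?case using relpow_0_I by (metis r_one)
  next
    case (incl w)
    then have "(u, u \<otimes> w) \<in> \<E>" if "u \<in> carrier G" for u
      using that unfolding cayley_arc_iff by auto
    then show ?case by (metis relpow_1)
  next
    case (inv w)
    then have "(u, u \<otimes> inv w) \<in> \<E>" if "u \<in> carrier G" for u
      using that X_inv unfolding cayley_arc_iff by auto
    then show ?case by (metis relpow_1)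
  next
    case (eng w w')
    then have w: "w \<in> carrier G" "w' \<in> carrier G" using generate_X_H by auto
    show ?case
    proof
      fix u assume u: "u \<in> carrier G"
      then obtain i j where "(u, u \<otimes> w) \<in> \<E> ^^ i" "(u \<otimes> w, u \<otimes> w \<otimes> w') \<in> \<E> ^^ j"
        using eng.IH w by blast
      then show "\<exists>n. (u, u \<otimes> (w \<otimes> w')) \<in> \<E> ^^ n"
        using relpow_trans m_assoc[OF u w] by metis
    qed
  qed
  show "\<exists>n. (u, v) \<in> \<E> ^^ n" if uv: "u \<in> carrier G" "v \<in> carrier G" for u v
  proof -
    have "inv u \<otimes> v \<in> generate G (X \<union> H)" using uv generate_X_H by simp
    moreover have "u \<otimes> (inv u \<otimes> v) = v" using uv by (simp add: m_assoc[symmetric])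
    ultimately show ?thesis using reach uv(1) by metis
  qed
qed

text \<open>Left translation by \<open>h\<close> preserves both \<open>H\<close> and its complement,
  hence the set of removed edges.\<close>

lemma relative_walk_translate:
  assumes "(u, v) \<in> \<R> ^^ n" "u \<in> carrier G" "h \<in> H"
  shows "(h \<otimes> u, h \<otimes> v) \<in> \<R> ^^ n \<and> v \<in> carrier G"
  using assms(1)
proof (induction n arbitrary: v)
  case 0
  then show ?case using assms(2) by simp
next
  case (Suc n)
  then obtain w where w: "(u, w) \<in> \<R> ^^ n" "(w, v) \<in> \<R>" by auto
  then obtain x where x: "w \<in> carrier G" "v = w \<otimes> x" "x \<in> X \<or> x \<in> H \<and> w \<notin> H"
    unfolding relative_arc_iff by auto
  then have xG: "x \<in> carrier G" using X_carrier by auto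
  have "h \<otimes> w \<notin> H" if "w \<notin> H"
  proof
    assume "h \<otimes> w \<in> H"
    then have "inv h \<otimes> (h \<otimes> w) \<in> H" using assms(3) by simp
    then show False using that x(1) assms(3) by (simp add: m_assoc[symmetric])
  qed
  moreover have "h \<otimes> v = h \<otimes> w \<otimes> x" using x xG assms(3) by (simp add: m_assoc)
  ultimately have "(h \<otimes> w, h \<otimes> v) \<in> \<R>"
    unfolding relative_arc_iff using x(1,3) assms(3) by auto
  then show ?case using Suc.IH[OF w(1)] x xG by auto
qed

text \<open>Invariance reduces \<rho> to its values \<open>\<rho> \<one> k\<close>, which are
  bounded on a relative ball because the ball is finite.\<close>

lemma displacement_bound:
  fixes \<rho> :: "'a \<Rightarrow> 'a \<Rightarrow> real"
  assumes invariant: "\<And>h k. \<lbrakk>h \<in> H; k \<in> H\<rbrakk> \<Longrightarrow> \<rho> h k = \<rho> \<one> (inv h \<otimes> k)"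
    and zero: "\<And>h. h \<in> H \<Longrightarrow> \<rho> h h \<le> 0"
    and triangle: "\<And>h k l. \<lbrakk>h \<in> H; k \<in> H; l \<in> H\<rbrakk> \<Longrightarrow> \<rho> h l \<le> \<rho> h k + \<rho> k l"
  shows "\<exists>B\<ge>0. \<forall>h\<in>H. \<forall>k\<in>H. \<forall>n. (h, k) \<in> \<R> ^^ n \<longrightarrow> \<rho> h k \<le> B * real n"
proof -
  interpret CG: connected_sym_graph "carrier G" \<E> by (rule connected_cayley)
  have verts: "verts (cayley_graph G X H) = carrier G" "verts (relative_graph G X H) = carrier G"
    by (simp_all add: cayley_graph_def relative_graph_def)
  obtain \<delta> where \<delta>: "CG.slim_triangles \<delta>"
    using C.hyperbolic_graph_slim_triangles[unfolded verts] connected_cayley hyperbolic by blast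
  define m where "m = 2 * \<delta> + 1"
  \<comment> \<open>The radius \<open>4 * m\<close> is the length up to which
    \<open>clique_displacement\<close> needs a bound; inserting 0 below keeps the maximum defined
    and nonnegative.\<close>
  define Y where "Y = {k \<in> H. relative_dist G X H \<one> k \<le> ereal (real (4 * m))}"
  define B where "B = Max (insert 0 (\<rho> \<one> ` Y))"
  have fin: "finite (insert 0 (\<rho> \<one> ` Y))"
    unfolding Y_def using locally_finite[OF H.one_closed] by blast
  have B0: "0 \<le> B" unfolding B_def using fin by (intro Max_ge) auto
  have "\<rho> h k \<le> B" if hk: "h \<in> H" "k \<in> H" "(h, k) \<in> \<R> ^^ i" "i \<le> 4 * m" for h k i
  proof -
    have "(\<one>, inv h \<otimes> k) \<in> \<R> ^^ i"
      using relative_walk_translate[OF hk(3), of "inv h"] hk by simp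
    then obtain p where p: "R.awalk \<one> p (inv h \<otimes> k)" "length p = i"
      using R.relpow_awalk verts by blast
    have "relative_dist G X H \<one> (inv h \<otimes> k) \<le> ereal (real i)"
      unfolding relative_dist_def using R.graph_dist_le[OF p(1)] p(2) by simp
    also have "\<dots> \<le> ereal (real (4 * m))" using hk by simp
    finally have "inv h \<otimes> k \<in> Y" unfolding Y_def using hk by simp
    then have "\<rho> \<one> (inv h \<otimes> k) \<le> B" unfolding B_def using fin by (intro Max_ge) auto
    then show ?thesis using invariant[OF hk(1,2)] by linarith
  qed
  then have "\<rho> h k \<le> B * real n" if "(h, k) \<in> \<R> ^^ n" "h \<in> H" "k \<in> H" for h k n
    by (intro CG.clique_displacement[OF cayley_arcs sym_relative \<delta> _ B0 zero triangle _ that, of m])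
      (auto simp: m_def)
  then show ?thesis using B0 by blast
qed

end

section \<open>The induced space\<close>

text \<open>The elements of \<open>Bij E\<close> are extensional functions, hence the assumption
  \<open>ext\<close>.\<close>

lemma group_actionI:
  assumes G: "group G"
    and closed: "\<And>g x. \<lbrakk>g \<in> carrier G; x \<in> E\<rbrakk> \<Longrightarrow> \<phi> g x \<in> E"
    and mult: "\<And>g h x. \<lbrakk>g \<in> carrier G; h \<in> carrier G; x \<in> E\<rbrakk> \<Longrightarrow> \<phi> (g \<otimes>\<^bsub>G\<^esub> h) x = \<phi> g (\<phi> h x)"
    and one: "\<And>x. x \<in> E \<Longrightarrow> \<phi> \<one>\<^bsub>G\<^esub> x = x"
    and ext: "\<And>g. g \<in> carrier G \<Longrightarrow> \<phi> g \<in> extensional E"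
  shows "group_action G E \<phi>"
proof -
  interpret group G by (rule G)
  have Bij: "\<phi> g \<in> Bij E" if g: "g \<in> carrier G" for g
  proof -
    have "bij_betw (\<phi> g) E E"
    proof (rule bij_betw_byWitness[where f' = "\<phi> (inv\<^bsub>G\<^esub> g)"])
      show "\<forall>a\<in>E. \<phi> (inv\<^bsub>G\<^esub> g) (\<phi> g a) = a" "\<forall>a\<in>E. \<phi> g (\<phi> (inv\<^bsub>G\<^esub> g) a) = a"
        using g one by (simp_all flip: mult)
    qed (use g closed in auto)
    then show ?thesis using ext g by (simp add: Bij_def)
  qed
  have "\<phi> \<in> hom G (BijGroup E)"
  proof (rule homI)
    fix g h assume gh: "g \<in> carrier G" "h \<in> carrier G"
    have "\<phi> (g \<otimes>\<^bsub>G\<^esub> h) = compose E (\<phi> g) (\<phi> h)"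
      by (rule extensionalityI[of _ E]) (use gh mult ext in \<open>auto simp: compose_def\<close>)
    then show "\<phi> (g \<otimes>\<^bsub>G\<^esub> h) = \<phi> g \<otimes>\<^bsub>BijGroup E\<^esub> \<phi> h"
      using gh Bij by (simp add: BijGroup_def)
  qed (simp add: BijGroup_def Bij)
  then show ?thesis
    unfolding group_action_def group_hom_def group_hom_axioms_def
    using G group_BijGroup by blast
qed

lemma mdist_self: "x \<in> mspace M \<Longrightarrow> mdist M x x = 0"
  by simp

text \<open>The condition \<open>base\<close> is an implication so that an empty \<open>M\<close>,
  which has no base point, is covered.\<close>

locale induced_space = hyperbolically_embedded_subgroup G H X
  for G :: "('g, 'm) monoid_scheme" (structure) and H X +
  fixes M :: "'r metric" and \<alpha> :: "'g \<Rightarrow> 'r \<Rightarrow> 'r" and s :: 'r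
  assumes isometric: "isometric_action (G\<lparr>carrier := H\<rparr>) M \<alpha>"
    and base: "r \<in> mspace M \<Longrightarrow> s \<in> mspace M"
begin

sublocale A: group_action "G\<lparr>carrier := H\<rparr>" "mspace M" \<alpha>
  using isometric unfolding isometric_action_def by blast

lemma act_closed: "\<lbrakk>h \<in> H; r \<in> mspace M\<rbrakk> \<Longrightarrow> \<alpha> h r \<in> mspace M"
  using A.element_image by auto

lemma act_mult: "\<lbrakk>h \<in> H; k \<in> H; r \<in> mspace M\<rbrakk> \<Longrightarrow> \<alpha> (h \<otimes> k) r = \<alpha> h (\<alpha> k r)"
  using A.composition_rule by simp

lemma act_one:
  assumes "r \<in> mspace M"
  shows "\<alpha> \<one> r = r"
proof -
  have "\<alpha> \<one> r = (\<lambda>x\<in>mspace M. x) r" using A.id_eq_one by simp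
  then show ?thesis using assms by simp
qed

lemma act_inv: "\<lbrakk>h \<in> H; r \<in> mspace M\<rbrakk> \<Longrightarrow> \<alpha> (inv h) (\<alpha> h r) = r"
  using act_mult[of "inv h" h r] act_one by simp

lemma act_isometric:
  "\<lbrakk>h \<in> H; r \<in> mspace M; r' \<in> mspace M\<rbrakk> \<Longrightarrow> mdist M (\<alpha> h r) (\<alpha> h r') = mdist M r r'"
  using isometric unfolding isometric_action_def by simp

text \<open>The point \<open>(g, r)\<close> stands for the point \<open>r\<close> in the copy of \<open>M\<close> attached to the coset \<open>gH\<close>,
  with \<open>(g, hr)\<close> and \<open>(gh, r)\<close> at distance 0; base points of the copies are joined along the
  letters from \<open>X\<close>.\<close>

inductive chain :: "'g \<times> 'r \<Rightarrow> 'g \<times> 'r \<Rightarrow> real \<Rightarrow> bool" for p where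
  refl: "chain p p 0"
| move: "\<lbrakk>chain p (g, r) c; r \<in> mspace M; r' \<in> mspace M\<rbrakk> \<Longrightarrow> chain p (g, r') (c + mdist M r r')"
| slide: "\<lbrakk>chain p (g, \<alpha> h r) c; g \<in> carrier G; h \<in> H; r \<in> mspace M\<rbrakk> \<Longrightarrow> chain p (g \<otimes> h, r) c"
| jump: "\<lbrakk>chain p (g, s) c; x \<in> X\<rbrakk> \<Longrightarrow> chain p (g \<otimes> x, s) (c + 1)"

section \<open>Calculus of chains\<close>

abbreviation "P \<equiv> carrier G \<times> mspace M"

lemma chain_closed: "chain p q c \<Longrightarrow> p \<in> P \<Longrightarrow> q \<in> P"
  by (induction rule: chain.induct) (use X_carrier in auto)

lemma chain_nonneg: "chain p q c \<Longrightarrow> 0 \<le> c"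
  by (induction rule: chain.induct) auto

lemma chain_trans: "chain q t c' \<Longrightarrow> chain p q c \<Longrightarrow> chain p t (c + c')"
proof (induction rule: chain.induct)
  case refl
  then show ?case by simp
next
  case (move g r c' r')
  then show ?case using chain.move[of p g r "c + c'" r'] by (simp add: add.assoc)
next
  case (slide g h r c')
  then show ?case by (auto intro: chain.slide)
next
  case (jump g c' x)
  then show ?case using chain.jump[of p g "c + c'" x] by (simp add: add.assoc)
qed

lemma chain_slide: "\<lbrakk>g \<in> carrier G; h \<in> H; r \<in> mspace M\<rbrakk> \<Longrightarrow> chain (g, \<alpha> h r) (g \<otimes> h, r) 0"
  by (rule chain.slide[OF chain.refl])

lemma chain_slide_back:
  assumes "g \<in> carrier G" "h \<in> H" "r \<in> mspace M"
  shows "chain (g \<otimes> h, r) (g, \<alpha> h r) 0"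
  using chain_slide[of "g \<otimes> h" "inv h" "\<alpha> h r"] assms act_closed
  by (simp add: act_inv m_assoc)

lemma chain_move: "\<lbrakk>r \<in> mspace M; r' \<in> mspace M\<rbrakk> \<Longrightarrow> chain (g, r) (g, r') (mdist M r r')"
  using chain.move[OF chain.refl] by fastforce

lemma chain_jump: "x \<in> X \<Longrightarrow> chain (g, s) (g \<otimes> x, s) 1"
  using chain.jump[OF chain.refl] by fastforce

lemma chain_jump_back:
  assumes "g \<in> carrier G" "x \<in> X"
  shows "chain (g \<otimes> x, s) (g, s) 1"
  using chain_jump[of "inv x" "g \<otimes> x"] assms X_inv X_carrier by (simp add: m_assoc)

text \<open>Every step can be undone at the same cost: a slide by \<open>h\<close> through
  \<open>inv h\<close>, a jump along \<open>x\<close> through \<open>inv x\<close>, which lies in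
  \<open>X\<close> by symmetry.\<close>

lemma chain_sym: "chain p q c \<Longrightarrow> p \<in> P \<Longrightarrow> chain q p c"
proof (induction rule: chain.induct)
  case refl
  show ?case by (rule chain.refl)
next
  case (move g r c r')
  then show ?case
    using chain_trans[OF _ chain_move[of r' r g]] by (simp add: mdist_commute add.commute)
next
  case (slide g h r c)
  then show ?case using chain_trans[OF _ chain_slide_back[of g h r]] by simp
next
  case (jump g c x)
  then have "g \<in> carrier G" using chain_closed by blast
  then have "chain (g \<otimes> x, s) p (1 + c)"
    using jump by (intro chain_trans[OF _ chain_jump_back]) auto
  then show ?case by (simp add: add.commute)
qed

abbreviation translate :: "'g \<Rightarrow> 'g \<times> 'r \<Rightarrow> 'g \<times> 'r" where
  "translate k p \<equiv> (k \<otimes> fst p, snd p)"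

text \<open>The steps multiply the group coordinate on the right only, so left multiplication
  carries chains to chains.\<close>

lemma chain_translate:
  "chain p q c \<Longrightarrow> p \<in> P \<Longrightarrow> k \<in> carrier G \<Longrightarrow> chain (translate k p) (translate k q) c"
proof (induction rule: chain.induct)
  case refl
  then show ?case by (simp add: chain.refl)
next
  case (move g r c r')
  then show ?case using chain.move by simp
next
  case (slide g h r c)
  then show ?case using chain.slide[of "translate k p" "k \<otimes> g" h r c] by (simp add: m_assoc)
next
  case (jump g c x)
  then have "g \<in> carrier G" using chain_closed by blast
  then show ?case
    using jump chain.jump[of "translate k p" "k \<otimes> g" c x] X_carrier by (simp add: m_assoc)
qed

lemma chain_base:
  assumes "w \<in> generate G (X \<union> H)" "s \<in> mspace M"
  shows "\<forall>u\<in>carrier G. \<exists>c. chain (u, s) (u \<otimes> w, s) c"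
proof -
  \<comment> \<open>An \<open>H\<close>-letter is realized by a move from \<open>s\<close> to
    \<open>\<alpha> h s\<close> inside the copy, followed by a slide.\<close>
  have H: "\<exists>c. chain (u, s) (u \<otimes> h, s) c" if "h \<in> H" "u \<in> carrier G" for u h
    using chain_trans[OF chain_slide chain_move] that assms(2) act_closed by blast
  show ?thesis
    using assms(1)
  proof induction
    case one
    then show ?case using chain.refl by (metis r_one)
  next
    case (incl w)
    then show ?case using incl H chain_jump by blast
  next
    case (inv w)
    then show ?case using inv H chain_jump X_inv H.m_inv_closed by blast
  next
    case (eng w w')
    then have w: "w \<in> carrier G" "w' \<in> carrier G" using generate_X_H by auto
    show ?case
    proof
      fix u assume u: "u \<in> carrier G"
      then obtain c c' where "chain (u, s) (u \<otimes> w, s) c" "chain (u \<otimes> w, s) (u \<otimes> w \<otimes> w', s) c'"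
        using eng.IH w by blast
      then show "\<exists>c. chain (u, s) (u \<otimes> (w \<otimes> w'), s) c"
        using chain_trans m_assoc[OF u w] by metis
    qed
  qed
qed

text \<open>Ensures that the infimum defining \<open>cost\<close> is taken over a nonempty set; both
  points are connected to the base points of their copies.\<close>

lemma chain_connected:
  assumes "p \<in> P" "q \<in> P"
  shows "\<exists>c. chain p q c"
proof -
  obtain g r g' r' where pq: "p = (g, r)" "q = (g', r')" by fastforce
  then have G: "g \<in> carrier G" "g' \<in> carrier G" and M: "r \<in> mspace M" "r' \<in> mspace M" "s \<in> mspace M"
    using assms base by auto
  have "inv g \<otimes> g' \<in> generate G (X \<union> H)" using generate_X_H G by simp
  moreover have "g \<otimes> (inv g \<otimes> g') = g'" using G by (simp add: m_assoc[symmetric])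
  ultimately obtain c where "chain (g, s) (g', s) c" using chain_base M(3) G(1) by metis
  then show ?thesis
    using chain_trans chain_move[OF M(1,3)] chain_move[OF M(3,2)] unfolding pq by meson
qed

text \<open>Outside of the coset \<open>H\<close>, the invariant records the element \<open>k\<close> at which the chain left \<open>H\<close>
  and a walk in the relative graph from \<open>k\<close> to the element \<open>e\<close> at which it entered the current
  coset. Each further jump adds at most two letters to this walk, whence the constant \<open>2 * B\<close>.\<close>

lemma chain_lower_bound:
  assumes B: "0 \<le> B"
    and bound: "\<And>h k n. \<lbrakk>h \<in> H; k \<in> H; (h, k) \<in> \<R> ^^ n\<rbrakk> \<Longrightarrow> mdist M (\<alpha> h s) (\<alpha> k s) \<le> B * real n"
    and L: "1 \<le> L" "2 * B \<le> L"
    and chain: "chain (\<one>, r) q c" and r: "r \<in> mspace M"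
  shows "if fst q \<in> H then mdist M r (\<alpha> (fst q) (snd q)) \<le> L * c
    else \<exists>k\<in>H. \<exists>e\<in>carrier G - H. \<exists>h\<in>H. \<exists>n. fst q = e \<otimes> h \<and> (k, e) \<in> \<R> ^^ n \<and>
           mdist M r (\<alpha> k s) + B * real n \<le> L * c"
  using chain
proof (induction rule: chain.induct)
  case refl
  show ?case using act_one r by (simp add: mdist_self)
next
  case (move g t c t')
  have d: "mdist M t t' \<le> L * mdist M t t'"
    using mult_right_mono[OF L(1) mdist_nonneg] by simp
  show ?case
  proof (cases "g \<in> H")
    case True
    then have "mdist M r (\<alpha> g t') \<le> mdist M r (\<alpha> g t) + mdist M (\<alpha> g t) (\<alpha> g t')"
      using move r act_closed by (intro mdist_triangle) auto
    then show ?thesis using move d True act_isometric by (simp add: algebra_simps)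
  next
    case False
    then obtain k e h n where "k \<in> H" "e \<in> carrier G - H" "h \<in> H" "g = e \<otimes> h" "(k, e) \<in> \<R> ^^ n"
      "mdist M r (\<alpha> k s) + B * real n \<le> L * c"
      using move.IH by auto
    moreover have "L * c \<le> L * (c + mdist M t t')" using L(1) by (simp add: mult_left_mono)
    ultimately show ?thesis using False by (fastforce intro: order_trans)
  qed
next
  case (slide g h t c)
  show ?case
  proof (cases "g \<in> H")
    case True
    then show ?thesis using slide act_mult by simp
  next
    case False
    \<comment> \<open>Sliding stays in the coset: \<open>k\<close> and \<open>e\<close> are kept,
      and \<open>h\<close> is absorbed into the offset \<open>h'\<close>.\<close>
    then have "g \<otimes> h \<notin> H"
      using slide H.m_closed[of "g \<otimes> h" "inv h"] by (auto simp: m_assoc)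
    moreover obtain k e h' n where k: "k \<in> H" "e \<in> carrier G - H" "h' \<in> H" "g = e \<otimes> h'" "(k, e) \<in> \<R> ^^ n"
      "mdist M r (\<alpha> k s) + B * real n \<le> L * c"
      using slide.IH False by auto
    moreover have "g \<otimes> h = e \<otimes> (h' \<otimes> h)" "h' \<otimes> h \<in> H" using k slide by (auto simp: m_assoc)
    ultimately show ?thesis by auto
  qed
next
  case (jump g c x)
  have g: "g \<in> carrier G" and s: "s \<in> mspace M" using chain_closed[OF jump.hyps(1)] r by auto
  have arc: "(g, g \<otimes> x) \<in> \<R>" unfolding relative_arc_iff using g jump by auto
  have x: "x \<in> carrier G" using jump X_carrier by auto
  \<comment> \<open>If \<open>g\<close> is in \<open>H\<close>, a new walk starts at
    \<open>k = g\<close>; otherwise the old one is prolonged.\<close>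
  have "\<exists>k\<in>H. \<exists>n. (k, g \<otimes> x) \<in> \<R> ^^ n \<and> mdist M r (\<alpha> k s) + B * real n \<le> L * (c + 1)"
  proof (cases "g \<in> H")
    case True
    then have "(g, g \<otimes> x) \<in> \<R> ^^ 1" using arc by simp
    moreover have "mdist M r (\<alpha> g s) + B * real 1 \<le> L * (c + 1)"
      using jump True L B by (simp add: algebra_simps)
    ultimately show ?thesis using True by blast
  next
    case False
    then obtain k e h n where k: "k \<in> H" "e \<in> carrier G - H" "h \<in> H" "g = e \<otimes> h" "(k, e) \<in> \<R> ^^ n"
      "mdist M r (\<alpha> k s) + B * real n \<le> L * c"
      using jump.IH by auto
    \<comment> \<open>Since \<open>e\<close> lies outside \<open>H\<close>, the edge from
      \<open>e\<close> with letter \<open>h\<close> has not been removed.\<close>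
    then have "(e, g) \<in> \<R>" unfolding relative_arc_iff by auto
    then have "(k, g \<otimes> x) \<in> \<R> ^^ Suc (Suc n)" using k(5) arc by auto
    moreover have "mdist M r (\<alpha> k s) + B * real (Suc (Suc n)) \<le> L * (c + 1)"
      using k(6) L(2) by (simp add: algebra_simps)
    ultimately show ?thesis using k(1) by blast
  qed
  then obtain k n where k: "k \<in> H" "(k, g \<otimes> x) \<in> \<R> ^^ n"
    "mdist M r (\<alpha> k s) + B * real n \<le> L * (c + 1)" by blast
  show ?case
  proof (cases "g \<otimes> x \<in> H")
    case True
    \<comment> \<open>The chain is back in \<open>H\<close>; \<open>bound\<close> turns the length
      of the excursion into a bound on the displacement of \<open>s\<close>.\<close>
    then have "mdist M r (\<alpha> (g \<otimes> x) s) \<le> mdist M r (\<alpha> k s) + mdist M (\<alpha> k s) (\<alpha> (g \<otimes> x) s)"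
      using r k s act_closed by (intro mdist_triangle) auto
    then show ?thesis using bound[OF k(1) True k(2)] k(3) True by simp
  next
    case False
    \<comment> \<open>The landing point \<open>g \<otimes> x\<close> becomes the new entry element,
      with trivial offset.\<close>
    then have "g \<otimes> x \<in> carrier G - H" "g \<otimes> x = g \<otimes> x \<otimes> \<one>" using g x by auto
    then have "\<exists>k\<in>H. \<exists>e\<in>carrier G - H. \<exists>h\<in>H. \<exists>n. g \<otimes> x = e \<otimes> h \<and> (k, e) \<in> \<R> ^^ n \<and>
        mdist M r (\<alpha> k s) + B * real n \<le> L * (c + 1)"
      using k H.one_closed by blast
    then show ?thesis using False by simp
  qed
qed

section \<open>The infimal chain cost and its invariance\<close>

definition cost :: "'g \<times> 'r \<Rightarrow> 'g \<times> 'r \<Rightarrow> real" where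
  "cost p q = Inf {c. chain p q c}"

lemma cost_le: "chain p q c \<Longrightarrow> cost p q \<le> c"
  unfolding cost_def using chain_nonneg by (intro cInf_lower bdd_belowI[of _ 0]) auto

lemma cost_greatest: "\<lbrakk>p \<in> P; q \<in> P; \<And>c. chain p q c \<Longrightarrow> z \<le> c\<rbrakk> \<Longrightarrow> z \<le> cost p q"
  unfolding cost_def using chain_connected by (intro cInf_greatest) auto

lemma cost_nonneg: "\<lbrakk>p \<in> P; q \<in> P\<rbrakk> \<Longrightarrow> 0 \<le> cost p q"
  by (rule cost_greatest) (auto dest: chain_nonneg)

lemma cost_sym:
  assumes "p \<in> P" "q \<in> P"
  shows "cost p q = cost q p"
proof -
  have "chain p q = chain q p" using chain_sym assms by blast
  then show ?thesis by (simp add: cost_def)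
qed

lemma cost_triangle:
  assumes "p \<in> P" "q \<in> P" "t \<in> P"
  shows "cost p t \<le> cost p q + cost q t"
proof -
  have "cost p t - c \<le> cost q t" if "chain p q c" for c
    using chain_trans[OF _ that] cost_le by (intro cost_greatest assms) (simp add: diff_le_eq add.commute)
  then have "cost p t - cost q t \<le> cost p q"
    by (intro cost_greatest assms) (simp add: algebra_simps)
  then show ?thesis by simp
qed

lemma translate_closed: "\<lbrakk>g \<in> carrier G; p \<in> P\<rbrakk> \<Longrightarrow> translate g p \<in> P"
  by (cases p) auto

lemma cost_translate:
  assumes "g \<in> carrier G" "p \<in> P" "q \<in> P"
  shows "cost (translate g p) (translate g q) = cost p q"
proof (rule antisym)
  \<comment> \<open>Stated for all \<open>g\<close>, so that the reverse inequality follows by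
    translating back with \<open>inv g\<close>.\<close>
  have le: "cost (translate g p) (translate g q) \<le> cost p q"
    if "g \<in> carrier G" "p \<in> P" "q \<in> P" for g p q
    using chain_translate cost_le that by (intro cost_greatest) auto
  show "cost (translate g p) (translate g q) \<le> cost p q" using le assms by blast
  have "translate (inv g) (translate g t) = t" if "t \<in> P" for t
    using that assms(1) by (cases t) (simp add: m_assoc[symmetric])
  then show "cost p q \<le> cost (translate g p) (translate g q)"
    using le[of "inv g" "translate g p" "translate g q"] assms translate_closed by simp
qed

text \<open>Adding 1 to all distances between distinct points turns the pseudometric \<open>cost\<close> into a metric
  without passing to a quotient.\<close>

definition dist1 :: "'g \<times> 'r \<Rightarrow> 'g \<times> 'r \<Rightarrow> real" where
  "dist1 p q = (if p \<in> P \<and> q \<in> P \<and> p \<noteq> q then 1 + cost p q else 0)"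

sublocale S: Metric_space P dist1
proof
  fix p q t
  show "0 \<le> dist1 p q" unfolding dist1_def using cost_nonneg by force
  show "dist1 p q = dist1 q p" unfolding dist1_def using cost_sym by auto
  show "(dist1 p q = 0) = (p = q)" if "p \<in> P" "q \<in> P"
    unfolding dist1_def using cost_nonneg[OF that] that by auto
  show "dist1 p t \<le> dist1 p q + dist1 q t" if "p \<in> P" "q \<in> P" "t \<in> P"
    unfolding dist1_def using cost_triangle[OF that] cost_nonneg that by auto
qed

abbreviation "induced_metric \<equiv> metric (P, dist1)"

abbreviation "induced_action \<equiv> \<lambda>g. \<lambda>p\<in>P. translate g p"

section \<open>The induced action as an extension\<close>

lemma isometric_induced_action: "isometric_action G induced_metric induced_action"
proof -
  have "group_action G P induced_action"
  proof (rule group_actionI[OF is_group])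
    fix g h p assume "g \<in> carrier G" "h \<in> carrier G" "p \<in> P"
    then show "induced_action (g \<otimes> h) p = induced_action g (induced_action h p)"
      by (cases p) (simp add: m_assoc)
  qed (use translate_closed in auto)
  moreover have "dist1 (translate g p) (translate g q) = dist1 p q"
    if "g \<in> carrier G" "p \<in> P" "q \<in> P" for g p q
  proof -
    have "translate g p = translate g q \<longleftrightarrow> p = q"
      using that by (cases p; cases q) auto
    then show ?thesis
      unfolding dist1_def using that translate_closed cost_translate by presburger
  qed
  ultimately show ?thesis unfolding isometric_action_def by simp
qed

text \<open>The upper bound comes from a single move, the lower one from
  \<open>chain_lower_bound\<close>, where \<open>displacement_bound\<close> is applied to the
  distance between the orbit points \<open>\<alpha> h s\<close> and
  \<open>\<alpha> k s\<close>.\<close>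

lemma quasi_isometric_induced: "quasi_isometric_embedding M induced_metric (\<lambda>r. (\<one>, r))"
proof (cases "s \<in> mspace M")
  case False
  then have "mspace M = {}" using base by auto
  then show ?thesis unfolding quasi_isometric_embedding_def by (auto intro: exI[of _ 1])
next
  case s: True
  have "\<exists>B\<ge>0. \<forall>h\<in>H. \<forall>k\<in>H. \<forall>n. (h, k) \<in> \<R> ^^ n \<longrightarrow> mdist M (\<alpha> h s) (\<alpha> k s) \<le> B * real n"
  proof (rule displacement_bound)
    fix h k assume hk: "h \<in> H" "k \<in> H"
    then have "mdist M (\<alpha> h s) (\<alpha> k s) = mdist M (\<alpha> (inv h) (\<alpha> h s)) (\<alpha> (inv h) (\<alpha> k s))"
      using s act_closed act_isometric by simp
    then show "mdist M (\<alpha> h s) (\<alpha> k s) = mdist M (\<alpha> \<one> s) (\<alpha> (inv h \<otimes> k) s)"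
      using hk s act_inv act_mult act_one by simp
  qed (use s in \<open>auto intro: mdist_triangle act_closed simp: mdist_self act_closed\<close>)
  then obtain B where B: "0 \<le> B" "\<And>h k n. \<lbrakk>h \<in> H; k \<in> H; (h, k) \<in> \<R> ^^ n\<rbrakk> \<Longrightarrow>
      mdist M (\<alpha> h s) (\<alpha> k s) \<le> B * real n" by blast
  define L where "L = 1 + 2 * B"
  have L: "1 \<le> L" "2 * B \<le> L" unfolding L_def using B(1) by auto
  have P: "(\<one>, r) \<in> P" if "r \<in> mspace M" for r using that by simp
  have "1 / L * mdist M r r' - L \<le> dist1 (\<one>, r) (\<one>, r') \<and> dist1 (\<one>, r) (\<one>, r') \<le> L * mdist M r r' + L"
    if r: "r \<in> mspace M" "r' \<in> mspace M" for r r'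
  proof (cases "r = r'")
    case True
    then show ?thesis using r L unfolding dist1_def by (simp add: mdist_self)
  next
    case False
    have "mdist M r r' / L \<le> c" if "chain (\<one>, r) (\<one>, r') c" for c
      using chain_lower_bound[OF B L that r(1)] r L(1) act_one
      by (simp add: divide_le_eq mult.commute)
    then have "mdist M r r' / L \<le> cost (\<one>, r) (\<one>, r')"
      by (intro cost_greatest P r)
    moreover have "cost (\<one>, r) (\<one>, r') \<le> mdist M r r'" using chain_move r by (intro cost_le)
    moreover have "mdist M r r' \<le> L * mdist M r r'"
      using mult_right_mono[OF L(1) mdist_nonneg] by simp
    moreover have "dist1 (\<one>, r) (\<one>, r') = 1 + cost (\<one>, r) (\<one>, r')"
      unfolding dist1_def using False P r by simp
    moreover have "1 / L * mdist M r r' = mdist M r r' / L" by simp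
    \<comment> \<open>The 1 added in \<open>dist1\<close> is absorbed by the additive constant, as
      \<open>L\<close> is at least 1.\<close>
    ultimately show ?thesis using L(1) by linarith
  qed
  then show ?thesis unfolding quasi_isometric_embedding_def using L(1) by (auto intro!: exI[of _ L])
qed

text \<open>A slide of cost 0 joins the two points, so only the 1 added in \<open>dist1\<close> can
  remain, uniformly in \<open>h\<close>.\<close>

lemma coarsely_equivariant_induced:
  "coarsely_equivariant H M \<alpha> induced_metric induced_action (\<lambda>r. (\<one>, r))"
  unfolding coarsely_equivariant_def
proof (intro ballI bdd_aboveI2)
  fix r h assume rh: "r \<in> mspace M" "h \<in> H"
  then have "chain (\<one>, \<alpha> h r) (h, r) 0" using chain_slide[of \<one> h r] by simp
  then have "dist1 (\<one>, \<alpha> h r) (h, r) \<le> 1" unfolding dist1_def using cost_le by force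
  then show "mdist induced_metric (\<one>, \<alpha> h r) (induced_action h (\<one>, r)) \<le> 1" using rh by simp
qed

lemma action_extension_induced: "action_extension G H M \<alpha> induced_metric induced_action"
  unfolding action_extension_def
  using isometric_induced_action coarsely_equivariant_induced quasi_isometric_induced by blast

end

theorem theorem1p8:
  fixes G :: "('g, 'm) monoid_scheme" and H :: "'g set"
  assumes "group G" and "subgroup H G" and "hyperbolically_embedded G H"
  shows "extension_problem_solvable TYPE('r) G H"
  unfolding extension_problem_solvable_def
proof (intro allI impI)
  fix M :: "'r metric" and \<alpha>
  assume act: "isometric_action (G\<lparr>carrier := H\<rparr>) M \<alpha>"
  obtain X where X: "hyperbolically_embedded_wrt G X H"
    using assms(3) unfolding hyperbolically_embedded_def by blast
  interpret induced_space G H X M \<alpha> "SOME s. s \<in> mspace M"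
  proof (intro induced_space.intro hyperbolically_embedded_subgroup.intro)
    show "hyperbolically_embedded_subgroup_axioms G H X" by unfold_locales (rule X)
    show "induced_space_axioms G H M \<alpha> (SOME s. s \<in> mspace M)"
      by unfold_locales (use act some_in_eq in auto)
  qed (use assms in auto)
  show "\<exists>(S :: ('g \<times> 'r) metric) \<beta>. action_extension G H M \<alpha> S \<beta>"
    using action_extension_induced by blast
qed

end
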